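(* Let $n\geq 2$ be an integer, let $A$ be a non-empty subset of $\mathbb Z_n'$ with $A\not\subseteq U(n)$, and let $S$ be a sequence in $\mathbb Z_n$. Then $S$ is a $D$-extremal sequence for $(A,\mathbb Z_n')$ if and only if $S$ is a $D$-extremal sequence for $A$.
   Context: $\mathbb Z_n=\mathbb Z/n\mathbb Z$ as a module over itself, $\mathbb Z_n'=\mathbb Z_n\setminus\{0\}$, $U(n)$ the group of units of $\mathbb Z_n$. A subsequence is a non-empty subfamily of terms in the original order. A sequence $(x_1,\ldots,x_k)$ is an $A$-weighted zero-sum sequence if there exist $a_i\in A$ with $\sum a_ix_i=0$, and an $(A,B)$-weighted zero-sum sequence if there exist $a_i\in A$, $b_i\in B$ with $\sum a_ix_i=0$ and $\sum b_ia_i=0$. $D_{A,B}(n)$ (resp. $D_A(n)$) is the least positive $k$ such that every sequence of length $k$ in $\mathbb Z_n$ has an $(A,B)$-weighted (resp. $A$-weighted) zero-sum subsequence. A $D$-extremal sequence for $(A,B)$ (resp. for $A$) is a sequence of length $D_{A,B}(n)-1$ (resp. $D_A(n)-1$) having no $(A,B)$-weighted (resp. $A$-weighted) zero-sum subsequence. *)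

theory Defs
  imports "HOL-Number_Theory.Residues" "HOL-Library.Sublist"
begin

text \<open>Sequences are lists over the carrier of \<open>residue_ring n\<close>; a subsequence is a
  non-empty list \<open>ys\<close> with \<open>subseq ys xs\<close>.\<close>

abbreviation nonzero_residues :: "int \<Rightarrow> int set" where
  "nonzero_residues n \<equiv> carrier (residue_ring n) - {\<zero>\<^bsub>residue_ring n\<^esub>}"

definition lincomb :: "int \<Rightarrow> int list \<Rightarrow> int list \<Rightarrow> int" where
  "lincomb n as xs =
     (\<Oplus>\<^bsub>residue_ring n\<^esub>i\<in>{..<length xs}. as ! i \<otimes>\<^bsub>residue_ring n\<^esub> xs ! i)"

definition weighted_zero_sum :: "int \<Rightarrow> int set \<Rightarrow> int list \<Rightarrow> bool" where
  "weighted_zero_sum n A xs \<longleftrightarrow>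
     (\<exists>as. length as = length xs \<and> set as \<subseteq> A \<and> lincomb n as xs = \<zero>\<^bsub>residue_ring n\<^esub>)"

definition weighted_zero_sum2 :: "int \<Rightarrow> int set \<Rightarrow> int set \<Rightarrow> int list \<Rightarrow> bool" where
  "weighted_zero_sum2 n A B xs \<longleftrightarrow>
     (\<exists>as bs. length as = length xs \<and> set as \<subseteq> A \<and> length bs = length xs \<and> set bs \<subseteq> B \<and>
        lincomb n as xs = \<zero>\<^bsub>residue_ring n\<^esub> \<and> lincomb n bs as = \<zero>\<^bsub>residue_ring n\<^esub>)"

definition has_subseq :: "(int list \<Rightarrow> bool) \<Rightarrow> int list \<Rightarrow> bool" where
  "has_subseq P xs \<longleftrightarrow> (\<exists>ys. ys \<noteq> [] \<and> subseq ys xs \<and> P ys)"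

definition D :: "int \<Rightarrow> int set \<Rightarrow> nat" where
  "D n A = (LEAST k. k > 0 \<and>
     (\<forall>xs. length xs = k \<and> set xs \<subseteq> carrier (residue_ring n) \<longrightarrow>
        has_subseq (weighted_zero_sum n A) xs))"

definition D2 :: "int \<Rightarrow> int set \<Rightarrow> int set \<Rightarrow> nat" where
  "D2 n A B = (LEAST k. k > 0 \<and>
     (\<forall>xs. length xs = k \<and> set xs \<subseteq> carrier (residue_ring n) \<longrightarrow>
        has_subseq (weighted_zero_sum2 n A B) xs))"

definition D_extremal :: "int \<Rightarrow> int set \<Rightarrow> int list \<Rightarrow> bool" where
  "D_extremal n A xs \<longleftrightarrow>
     set xs \<subseteq> carrier (residue_ring n) \<and> length xs = D n A - 1 \<and>
     \<not> has_subseq (weighted_zero_sum n A) xs"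

definition D2_extremal :: "int \<Rightarrow> int set \<Rightarrow> int set \<Rightarrow> int list \<Rightarrow> bool" where
  "D2_extremal n A B xs \<longleftrightarrow>
     set xs \<subseteq> carrier (residue_ring n) \<and> length xs = D2 n A B - 1 \<and>
     \<not> has_subseq (weighted_zero_sum2 n A B) xs"

end

theory Submission
  imports Defs
begin

text \<open>An \<open>A\<close>-weighted zero-sum sequence is already \<open>(A, \<int>\<^sub>n')\<close>-weighted zero-sum, so the two
  notions, and hence the two constants, coincide. For a sequence of length at least 2 the weights
  \<open>a\<^sub>i\<close> themselves admit a relation with non-zero coefficients: pairs \<open>(a, a')\<close> are cancelled by
  \<open>(a', -a)\<close>, and at most one triple remains, which is handled by annihilating a non-unit or, if all
  three are units, by \<open>1 + 1 - 2 = 0\<close> (here \<open>n \<ge> 3\<close>). For length 1 one has \<open>a x = 0\<close>; if \<open>a\<close> is a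
  unit then \<open>x = 0\<close>, and \<open>a\<close> may be exchanged for a non-unit of \<open>A\<close>, which has a non-zero
  annihilator.\<close>

text \<open>Turns the finite sum in the residue ring into an integer sum, so that vanishing becomes
  divisibility by \<open>n\<close> and coefficients may be arbitrary integers.\<close>

lemma lincomb_eq:
  assumes "n \<ge> 2" "length as = length xs"
  shows "lincomb n as xs = sum_list (map2 (*) as xs) mod n"
proof -
  interpret residues n "residue_ring n"
    using assms(1) by unfold_locales auto
  have "(\<Oplus>\<^bsub>residue_ring n\<^esub>i\<in>I. as ! i \<otimes>\<^bsub>residue_ring n\<^esub> xs ! i)
      = (\<Sum>i\<in>I. as ! i * xs ! i) mod n" if "finite I" for I
    using that
  proof induction
    case empty
    then show ?case by (simp add: zero_cong)
  next
    case (insert i I)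
    have "(\<lambda>i. as ! i \<otimes>\<^bsub>residue_ring n\<^esub> xs ! i) \<in> J \<rightarrow> carrier (residue_ring n)" for J
      by (auto simp: res_mult_eq)
    with insert show ?case
      by (simp add: finsum_insert res_mult_eq res_add_eq mod_add_eq Pi_iff)
  qed
  then show ?thesis
    using assms(2) by (simp add: lincomb_def sum_list_sum_nth atLeast0LessThan)
qed

lemma mem_nonzero_residues_iff: "a \<in> nonzero_residues n \<longleftrightarrow> 0 < a \<and> a < n"
  by (auto simp: residue_ring_def)

text \<open>The witness is \<open>n div gcd a n\<close>: as the gcd exceeds 1, it lies strictly
  between 0 and \<open>n\<close>, and its product with \<open>a\<close> is
  \<open>n * (a div gcd a n)\<close>.\<close>

lemma ex_annihilator:
  fixes a n :: int
  assumes "n > 0" "\<not> coprime a n"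
  shows "\<exists>b. \<not> n dvd b \<and> n dvd b * a"
proof (intro exI conjI)
  let ?g = "gcd a n"
  have "?g > 1"
    using assms coprime_iff_gcd_eq_1 [of a n] gcd_pos_int [of a n] by linarith
  then have "0 < n div ?g" "n div ?g < n"
    using assms(1) by (simp_all add: pos_imp_zdiv_pos_iff zdvd_imp_le int_div_less_self)
  then show "\<not> n dvd n div ?g"
    using zdvd_not_zless by blast
  have "n div ?g * a = n * (a div ?g)"
    using dvd_div_mult [of ?g n a] div_mult_swap [of ?g a n] by simp
  then show "n dvd n div ?g * a"
    by simp
qed

text \<open>The bound on \<open>n\<close> is sharp: modulo 2 all six numbers would be odd, and so
  would the sum.\<close>

lemma ex_nonzero_relation3:
  fixes a b c n :: int
  assumes "n \<ge> 3" "\<not> n dvd a" "\<not> n dvd b" "\<not> n dvd c"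
  shows "\<exists>u v w. \<not> n dvd u \<and> \<not> n dvd v \<and> \<not> n dvd w \<and> n dvd u * a + v * b + w * c"
proof -
  have nonunit: "\<exists>u v w. \<not> n dvd u \<and> \<not> n dvd v \<and> \<not> n dvd w \<and> n dvd u * x + v * y + w * z"
    if xyz: "\<not> coprime x n" "\<not> n dvd y" "\<not> n dvd z" for x y z :: int
  proof -
    obtain u where "\<not> n dvd u" "n dvd u * x"
      using ex_annihilator [of n x] xyz(1) assms(1) by auto
    then show ?thesis
      \<comment> \<open>\<open>u\<close> kills \<open>x\<close>, and
        \<open>z * y - y * z = 0\<close> disposes of the rest.\<close>
      using xyz by (intro exI [of _ u] exI [of _ z] exI [of _ "- y"]) auto
  qed
  show ?thesis
  proof (cases "coprime a n \<and> coprime b n \<and> coprime c n")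
    case True
    then obtain u v w where inv: "[a * u = 1] (mod n)" "[b * v = 1] (mod n)" "[c * w = 1] (mod n)"
      using cong_solve_coprime_int by meson
    have unit: "\<not> n dvd t" if "[s * t = 1] (mod n)" for s t
    proof
      assume "n dvd t"
      then have "n dvd s * t" by simp
      then have "n dvd 1" using cong_dvd_iff [OF that] by blast
      then show False using assms(1) by simp
    qed
    \<comment> \<open>The coefficients are the inverses of \<open>a\<close>, \<open>b\<close>,
      \<open>c\<close>, scaled by 1, 1 and -2.\<close>
    have "[a * u + b * v - 2 * (c * w) = 1 + 1 - 2 * 1] (mod n)"
      using inv by (intro cong_diff cong_add cong_mult cong_refl)
    then have "n dvd u * a + v * b + (- 2 * w) * c"
      by (simp add: cong_0_iff algebra_simps)
    \<comment> \<open>Multiplying by \<open>- c\<close> cancels \<open>w\<close> modulo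
      \<open>n\<close> and would leave \<open>n dvd 2\<close>.\<close>
    moreover have "\<not> n dvd - 2 * w"
    proof
      assume "n dvd - 2 * w"
      then have "n dvd 2 * (c * w)"
        using dvd_mult [of n "- 2 * w" "- c"] by (simp add: mult.left_commute)
      moreover have "[2 * (c * w) = 2 * 1] (mod n)"
        using inv by (intro cong_mult cong_refl)
      ultimately have "n dvd 2"
        using cong_dvd_iff by fastforce
      then show False
        using assms(1) zdvd_not_zless [of 2 n] by simp
    qed
    ultimately show ?thesis
      using unit [OF inv(1)] unit [OF inv(2)] by blast
  next
    case False
    then consider "\<not> coprime a n" | "\<not> coprime b n" | "\<not> coprime c n" by blast
    then show ?thesis
    proof cases
      case 1
      then show ?thesis using nonunit [of a b c] assms by blast
    next
      case 2
      then obtain u v w where "\<not> n dvd u" "\<not> n dvd v" "\<not> n dvd w" "n dvd u * b + v * a + w * c"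
        using nonunit [of b a c] assms by blast
      then show ?thesis
        by (intro exI [of _ v] exI [of _ u] exI [of _ w]) (simp add: algebra_simps)
    next
      case 3
      then obtain u v w where "\<not> n dvd u" "\<not> n dvd v" "\<not> n dvd w" "n dvd u * c + v * a + w * b"
        using nonunit [of c a b] assms by blast
      then show ?thesis
        by (intro exI [of _ v] exI [of _ w] exI [of _ u]) (simp add: algebra_simps)
    qed
  qed
qed

text \<open>Strong induction on the length, since each step removes two entries. It recurses only if
  at least two entries remain, so it ends at length 2 or 3, never at a single entry that might be a
  unit.\<close>

lemma ex_nonzero_relation:
  fixes n :: int and as :: "int list"
  assumes "n \<ge> 3" "length as \<ge> 2" "\<forall>a\<in>set as. \<not> n dvd a"
  shows "\<exists>bs. length bs = length as \<and> (\<forall>b\<in>set bs. \<not> n dvd b) \<and> n dvd sum_list (map2 (*) bs as)"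
  using assms(2,3)
proof (induction "length as" arbitrary: as rule: less_induct)
  case less
  then obtain a b cs where as: "as = a # b # cs"
    by (metis Suc_le_length_iff numeral_2_eq_2)
  consider "cs = []" | c where "cs = [c]" | "length cs \<ge> 2"
    by (cases cs; cases "tl cs") auto
  then show ?case
  proof cases
    case 1
    then show ?thesis
      using less.prems as by (intro exI [of _ "[b, - a]"]) auto
  next
    case (2 c)
    then obtain u v w where "\<not> n dvd u" "\<not> n dvd v" "\<not> n dvd w" "n dvd u * a + v * b + w * c"
      using ex_nonzero_relation3 [OF assms(1), of a b c] less.prems as by auto
    then show ?thesis
      using 2 as by (intro exI [of _ "[u, v, w]"]) (auto simp: add.assoc)
  next
    case 3
    then obtain ds where "length ds = length cs" "\<forall>d\<in>set ds. \<not> n dvd d"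
        "n dvd sum_list (map2 (*) ds cs)"
      using less.hyps [of cs] less.prems as by auto
    then show ?thesis
      using less.prems as by (intro exI [of _ "b # - a # ds"]) auto
  qed
qed

text \<open>Lets integer coefficients such as \<open>- a\<close> be replaced by their residues,
  which lie in the carrier.\<close>

lemma dvd_sum_list_map2_mod_iff:
  fixes n :: int
  assumes "length bs = length as"
  shows "n dvd sum_list (map2 (*) (map (\<lambda>b. b mod n) bs) as) \<longleftrightarrow> n dvd sum_list (map2 (*) bs as)"
proof -
  have "[sum_list (map2 (*) (map (\<lambda>b. b mod n) bs) as) = sum_list (map2 (*) bs as)] (mod n)"
    using assms by (induction bs as rule: list_induct2) (auto intro!: cong_add cong_mult)
  then show ?thesis
    by (rule cong_dvd_iff)
qed

lemma weighted_zero_sum2_nonzero_residues_iff: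
  assumes n: "n \<ge> 2" and A: "A \<subseteq> nonzero_residues n" and nonunit: "\<not> A \<subseteq> Units (residue_ring n)"
  shows "weighted_zero_sum2 n A (nonzero_residues n) xs \<longleftrightarrow> weighted_zero_sum n A xs"
proof
  assume "weighted_zero_sum2 n A (nonzero_residues n) xs"
  then show "weighted_zero_sum n A xs"
    unfolding weighted_zero_sum_def weighted_zero_sum2_def by blast
next
  interpret residues n "residue_ring n"
    using n by unfold_locales auto
  have zero_iff: "lincomb n as ys = \<zero>\<^bsub>residue_ring n\<^esub> \<longleftrightarrow> n dvd sum_list (map2 (*) as ys)"
    if "length as = length ys" for as ys
    using lincomb_eq [OF n that] by (simp add: res_zero_eq dvd_eq_mod_eq_0)
  have A_bounds: "0 < a \<and> a < n" if "a \<in> A" for a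
    using that A mem_nonzero_residues_iff by blast
  obtain c where c: "c \<in> A" "\<not> coprime c n"
    using A_bounds nonunit by (auto simp: res_units_eq)
  \<comment> \<open>The only non-zero residue modulo 2 is the unit 1, whereas \<open>c\<close> is a
    non-unit.\<close>
  have "n \<noteq> 2"
  proof
    assume "n = 2"
    with A_bounds [OF c(1)] have "c = 1" by simp
    with c(2) show False by simp
  qed
  with n have n3: "n \<ge> 3" by simp
  have A_dvd: "\<not> n dvd a" if "a \<in> A" for a
    using that A_bounds zdvd_not_zless by blast
  assume "weighted_zero_sum n A xs"
  then obtain as where as: "length as = length xs" "set as \<subseteq> A" "n dvd sum_list (map2 (*) as xs)"
    unfolding weighted_zero_sum_def using zero_iff by blast
  \<comment> \<open>The weights \<open>as\<close> are quantified anew because for length 1 the given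
    weight may have to be exchanged.\<close>
  have "\<exists>as bs. length as = length xs \<and> set as \<subseteq> A \<and> n dvd sum_list (map2 (*) as xs)
      \<and> length bs = length as \<and> (\<forall>b\<in>set bs. \<not> n dvd b) \<and> n dvd sum_list (map2 (*) bs as)"
  proof -
    consider "xs = []" | x where "xs = [x]" | "length xs \<ge> 2"
      by (cases xs; cases "tl xs") auto
    then show ?thesis
    proof cases
      case 1
      then show ?thesis by simp
    next
      case (2 x)
      with as obtain a where a: "as = [a]" "a \<in> A" "n dvd a * x"
        by (cases as) auto
      have "\<exists>d\<in>A. \<not> coprime d n \<and> n dvd d * x"
      proof (cases "coprime a n")
        case True
        then have "n dvd x"
          using a(3) by (simp add: coprime_commute coprime_dvd_mult_right_iff)
        with c show ?thesis by auto
      qed (use a in blast)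
      then obtain d where d: "d \<in> A" "\<not> coprime d n" "n dvd d * x" by blast
      then obtain b where "\<not> n dvd b" "n dvd b * d"
        using ex_annihilator [of n d] n by auto
      with d 2 show ?thesis
        by (intro exI [of _ "[d]"] exI [of _ "[b]"]) simp
    next
      case 3
      then have "\<exists>bs. length bs = length as \<and> (\<forall>b\<in>set bs. \<not> n dvd b)
          \<and> n dvd sum_list (map2 (*) bs as)"
        using as A_dvd by (intro ex_nonzero_relation [OF n3]) auto
      with as show ?thesis by blast
    qed
  qed
  then obtain as bs where *: "length as = length xs" "set as \<subseteq> A" "n dvd sum_list (map2 (*) as xs)"
      "length bs = length as" "\<forall>b\<in>set bs. \<not> n dvd b" "n dvd sum_list (map2 (*) bs as)"
    by blast
  \<comment> \<open>Reduction modulo \<open>n\<close> keeps the relation and makes each coefficient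
    a non-zero residue.\<close>
  let ?bs = "map (\<lambda>b. b mod n) bs"
  have "set ?bs \<subseteq> nonzero_residues n"
  proof
    fix r assume "r \<in> set ?bs"
    then obtain b where "r = b mod n" "\<not> n dvd b" using *(5) by auto
    then show "r \<in> nonzero_residues n"
      unfolding mem_nonzero_residues_iff
      using n pos_mod_bound [of n b] pos_mod_sign [of n b]
      by (simp add: dvd_eq_mod_eq_0 order_less_le)
  qed
  moreover have "n dvd sum_list (map2 (*) ?bs as)"
    using * by (simp only: dvd_sum_list_map2_mod_iff)
  ultimately show "weighted_zero_sum2 n A (nonzero_residues n) xs"
    unfolding weighted_zero_sum2_def using *
    by (intro exI [of _ as] exI [of _ ?bs]) (simp add: zero_iff)
qed

theorem theorem19:
  fixes n :: int and A :: "int set" and S :: "int list"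
  assumes "n \<ge> 2"
    and "A \<noteq> {}"
    and "A \<subseteq> nonzero_residues n"
    and "\<not> A \<subseteq> Units (residue_ring n)"
    and "set S \<subseteq> carrier (residue_ring n)"
  shows "D2_extremal n A (nonzero_residues n) S \<longleftrightarrow> D_extremal n A S"
proof -
  \<comment> \<open>As an equation between predicates this rewrites inside \<open>LEAST\<close> too,
    so \<open>D2\<close> and \<open>D\<close> agree by unfolding.\<close>
  have "weighted_zero_sum2 n A (nonzero_residues n) = weighted_zero_sum n A"
    using weighted_zero_sum2_nonzero_residues_iff [OF assms(1,3,4)] by blast
  then show ?thesis
    by (simp only: D2_extremal_def D_extremal_def D2_def D_def)
qed

end
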